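(* Let $K:(0,\infty)\to\mathbb{R}$ be $C^1$ and strictly decreasing with $\int_0^1 K(r)\,r\,dr<\infty$, and let $D(\Omega)=\int_\Omega\int_\Omega K(|x-y|)\,dx\,dy$. Let $a>0$, $x_A,x_C\in\mathbb{R}$ and $y_A,y_C\in\mathbb{R}$ with $y_Ay_C<0$. For $0\le t\le1$ let $\Omega_t\subset\mathbb{R}^2$ be the quadrilateral with (consecutive) vertices $A_t=(x_A(1-t),y_A)$, $B=(a,0)$, $C_t=(x_C(1-t),y_C)$ and $D=(-a,0)$. If both $x_A$ and $x_C$ are not zero, then $t\mapsto D(\Omega_t)$ is a strictly increasing function for $0\le t\le1$.
   Context: The quadrilateral $\Omega_t$ is the region enclosed by the closed polygon $A_tBC_tD$, i.e. (up to a null set) the union of the triangles with vertices $A_t,B,D$ and $C_t,B,D$; it need not be convex. The letter $D$ alone denotes a vertex, while $D(\cdot)$ denotes the energy functional. The condition $\int_0^1K(r)r\,dr<\infty$ guarantees that $D(\cdot)$ is finite on bounded planar domains. *)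

theory Defs
  imports "HOL-Analysis.Analysis"
begin

text \<open>The Euclidean plane is represented by the type \<^typ>\<open>real \<times> real\<close>, whose library norm is
  the Euclidean norm and whose \<^const>\<open>lborel\<close> is the two-dimensional Lebesgue measure.\<close>

text \<open>Only the values of \<open>K\<close> on \<open>(0,\<infinity>)\<close> matter: the diagonal \<open>x = y\<close>, where \<open>K 0\<close> occurs, is a
  null set. As \<^const>\<open>set_lebesgue_integral\<close> is 0 for non-integrable functions, this is
  the double integral only if the latter is finite. That is the case for every bounded open
  \<open>\<Omega>\<close> if \<open>K\<close> is continuous and decreasing on \<open>(0,\<infinity>)\<close> and \<open>K r * r\<close> is integrable on \<open>(0,1)\<close>.\<close>

definition energy :: "(real \<Rightarrow> real) \<Rightarrow> (real \<times> real) set \<Rightarrow> real" where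
  "energy K \<Omega> = (LINT y:\<Omega>|lborel. (LINT x:\<Omega>|lborel. K (norm (x - y))))"

text \<open>The open region enclosed by the closed polygon with consecutive vertices \<open>P, Q, R, S\<close>; including
  the boundary or not makes no difference for the energy, since the polygon is a null set.\<close>

definition quadrilateral ::
    "real \<times> real \<Rightarrow> real \<times> real \<Rightarrow> real \<times> real \<Rightarrow> real \<times> real \<Rightarrow> (real \<times> real) set" where
  "quadrilateral P Q R S =
     inside (path_image (linepath P Q +++ linepath Q R +++ linepath R S +++ linepath S P))"

end

theory Submission
  imports Defs
begin

text \<open>Cut \<open>\<Omega>\<^sub>t\<close> into horizontal slices. With \<open>s = 1 - t\<close>, the slice at height \<open>y\<close> is an interval of
  half-length \<open>w(y)\<close> centred at \<open>s m(y)\<close>, where \<open>m\<close> and \<open>w\<close> do not depend on \<open>t\<close>. By Tonelli the energy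
  is the integral over pairs of heights \<open>y, y'\<close> of the interaction of two slices. For \<open>y \<noteq> y'\<close> the
  kernel, as a function of the horizontal displacement, is even, continuous and strictly decreasing
  in the modulus. Averaging over a centred window preserves these properties, so the interaction is
  such a function of the distance \<open>s (m(y) - m(y'))\<close> of the centres. Hence it decreases in \<open>s\<close>,
  strictly whenever \<open>m(y) \<noteq> m(y')\<close>, in particular when \<open>y, y'\<close> both lie strictly between \<open>0\<close> and \<open>y\<^sub>A\<close>.

  To work with Tonelli only, \<open>K\<close> is replaced by a positive kernel that differs from it by a constant
  up to the diameter; the additive constant contributes a multiple of the squared area, which does
  not depend on \<open>t\<close>.\<close>

section \<open>Even profiles on the line that decrease in the modulus\<close>

text \<open>Positivity is included so that strict inequalities survive \<open>ennreal\<close>, which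
  sends negative reals to 0.\<close>

definition bump :: "(real \<Rightarrow> real) \<Rightarrow> bool" where
  "bump k \<longleftrightarrow> continuous_on UNIV k \<and> (\<forall>x. 0 < k x) \<and> (\<forall>x. k (- x) = k x) \<and>
     (\<forall>x y. \<bar>x\<bar> < \<bar>y\<bar> \<longrightarrow> k y < k x)"

lemma bumpI:
  assumes "continuous_on UNIV k" "\<And>x. 0 < k x" "\<And>x. k (- x) = k x"
    "\<And>x y. 0 \<le> x \<Longrightarrow> x < y \<Longrightarrow> k y < k x"
  shows "bump k"
proof -
  have "k \<bar>x\<bar> = k x" for x using assms(3) by (simp add: abs_if)
  then show ?thesis
    unfolding bump_def using assms by (metis abs_ge_zero)
qed

text \<open>With an antiderivative \<open>F\<close> of \<open>k\<close>, the window integral is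
  \<open>F (x + p) - F (x - p)\<close> at \<open>x = c - b\<close>. Its derivative
  \<open>k (x + p) - k (x - p)\<close> is negative for \<open>x > 0\<close>, because
  \<open>x - p\<close> is then closer to 0 than \<open>x + p\<close>.\<close>

lemma bump_window:
  assumes k: "bump k" and p: "p > 0"
  obtains k' where "bump k'"
    "\<And>b c. (\<integral>\<^sup>+x. ennreal (k (x - b)) * indicator {c - p<..<c + p} x \<partial>lborel) = ennreal (k' (c - b))"
proof -
  have cont: "isCont k x" for x
    using k by (simp add: bump_def continuous_on_eq_continuous_at)
  have pos: "0 < k x" and even: "k (- x) = k x" for x
    using k by (auto simp: bump_def)
  obtain F where "\<forall>x. (F has_vector_derivative k x) (at x)"
    using einterval_antiderivative[of "-\<infinity>" "\<infinity>" k] cont by auto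
  then have F: "(F has_real_derivative k x) (at x)" for x
    by (simp add: has_real_derivative_iff_has_vector_derivative)
  note [derivative_intros] = DERIV_chain2[OF F]
  \<comment> \<open>As \<open>k\<close> is even, \<open>F\<close> is odd up to an additive constant;
    this makes \<open>k'\<close> even.\<close>
  have "((\<lambda>x. F x + F (- x)) has_real_derivative 0) (at x)" for x
    by (auto intro!: derivative_eq_intros simp: even)
  then have F_odd: "F x + F (- x) = F 0 + F (- 0)" for x
    using DERIV_isconst_all by blast
  define k' where "k' x = F (x + p) - F (x - p)" for x
  have der: "(k' has_real_derivative (k (x + p) - k (x - p))) (at x)" for x
    unfolding k'_def by (auto intro!: derivative_eq_intros)
  have "bump k'"
  proof (rule bumpI)
    show c: "continuous_on UNIV k'"
      using DERIV_isCont[OF der] by (simp add: continuous_on_eq_continuous_at)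
    show "0 < k' x" for x
      using DERIV_pos_imp_increasing[of "x - p" "x + p" F] F pos p by (force simp: k'_def)
    show "k' (- x) = k' x" for x
      using F_odd[of "x - p"] F_odd[of "x + p"] by (simp add: k'_def)
    show "k' y < k' x" if "0 \<le> x" "x < y" for x y
    proof (rule DERIV_neg_imp_decreasing_open[OF that(2)])
      fix t assume t: "x < t" "t < y"
      then have "\<bar>t - p\<bar> < \<bar>t + p\<bar>" using that p by linarith
      then have "k (t + p) < k (t - p)" using k by (simp add: bump_def)
      then show "\<exists>z. (k' has_real_derivative z) (at t) \<and> z < 0"
        using der by (meson diff_less_0_iff_less)
    qed (rule continuous_on_subset[OF c], simp)
  qed
  moreover have "(\<integral>\<^sup>+x. ennreal (k (x - b)) * indicator {c - p<..<c + p} x \<partial>lborel) = ennreal (k' (c - b))" for b c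
  proof -
    have [measurable]: "k \<in> borel_measurable borel"
      using k by (simp add: bump_def borel_measurable_continuous_onI)
    have "(\<integral>\<^sup>+x. ennreal (k (x - b)) * indicator {c - p<..<c + p} x \<partial>lborel)
        = (\<integral>\<^sup>+x. ennreal (k (x - b)) * indicator {c - p..c + p} x \<partial>lborel)"
      using AE_lborel_singleton[of "c - p"] AE_lborel_singleton[of "c + p"]
      by (intro nn_integral_cong_AE) (auto split: split_indicator)
    also have "\<dots> = ennreal (F (c + p - b) - F (c - p - b))"
    proof (rule nn_integral_FTC_Icc)
      show "((\<lambda>x. F (x - b)) has_real_derivative k (x - b)) (at x)" for x
        by (auto intro!: derivative_eq_intros)
    qed (use p pos in \<open>auto simp: less_imp_le\<close>)
    finally show ?thesis by (simp add: k'_def algebra_simps)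
  qed
  ultimately show ?thesis using that by blast
qed

section \<open>Tonelli and translation invariance in the plane\<close>

lemma nn_integral_plane:
  assumes [measurable]: "g \<in> borel_measurable (borel :: (real \<times> real) measure)"
  shows "(\<integral>\<^sup>+z. g z \<partial>lborel) = (\<integral>\<^sup>+y. \<integral>\<^sup>+x. g (x, y) \<partial>lborel \<partial>lborel)"
proof -
  have "g \<in> borel_measurable (lborel \<Otimes>\<^sub>M lborel)"
    by (simp add: lborel_prod)
  from lborel_pair.nn_integral_snd[OF this] show ?thesis
    by (simp add: lborel_prod)
qed

text \<open>Moves the two heights outermost, so that the inner double integral is the interaction of
  two horizontal slices.\<close>

lemma nn_integral_two_planes:
  fixes f :: "real \<times> real \<Rightarrow> real \<times> real \<Rightarrow> ennreal"
  assumes [measurable]: "case_prod f \<in> borel_measurable (borel \<Otimes>\<^sub>M borel)"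
  shows "(\<integral>\<^sup>+z'. \<integral>\<^sup>+z. f z z' \<partial>lborel \<partial>lborel)
    = (\<integral>\<^sup>+y'. \<integral>\<^sup>+y. \<integral>\<^sup>+x'. \<integral>\<^sup>+x. f (x, y) (x', y') \<partial>lborel \<partial>lborel \<partial>lborel \<partial>lborel)"
proof -
  have [measurable (raw)]: "(\<lambda>u. f (g u) (h u)) \<in> borel_measurable M"
    if [measurable]: "g \<in> borel_measurable M" "h \<in> borel_measurable M" for g h and M :: "'a measure"
  proof -
    have "(\<lambda>u. case_prod f (g u, h u)) \<in> borel_measurable M" by measurable
    then show ?thesis by simp
  qed
  have "(\<integral>\<^sup>+z'. \<integral>\<^sup>+z. f z z' \<partial>lborel \<partial>lborel)
    = (\<integral>\<^sup>+z'. \<integral>\<^sup>+y. \<integral>\<^sup>+x. f (x, y) z' \<partial>lborel \<partial>lborel \<partial>lborel)"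
    by (subst nn_integral_plane) auto
  also have "\<dots> = (\<integral>\<^sup>+y'. \<integral>\<^sup>+x'. \<integral>\<^sup>+y. \<integral>\<^sup>+x. f (x, y) (x', y') \<partial>lborel \<partial>lborel \<partial>lborel \<partial>lborel)"
    by (subst nn_integral_plane) auto
  also have "\<dots> = (\<integral>\<^sup>+y'. \<integral>\<^sup>+y. \<integral>\<^sup>+x'. \<integral>\<^sup>+x. f (x, y) (x', y') \<partial>lborel \<partial>lborel \<partial>lborel \<partial>lborel)"
    by (subst lborel_pair.Fubini') auto
  finally show ?thesis .
qed

lemma nn_integral_lborel_translate:
  fixes f :: "'a::euclidean_space \<Rightarrow> ennreal"
  assumes [measurable]: "f \<in> borel_measurable borel"
  shows "(\<integral>\<^sup>+z. f (z - a) \<partial>lborel) = (\<integral>\<^sup>+z. f z \<partial>lborel)"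
proof -
  have "(\<integral>\<^sup>+z. f z \<partial>lborel) = (\<integral>\<^sup>+z. f z \<partial>distr lborel borel ((+) (- a)))"
    by (simp add: lborel_distr_plus)
  also have "\<dots> = (\<integral>\<^sup>+z. f (z - a) \<partial>lborel)"
    by (subst nn_integral_distr) auto
  finally show ?thesis by simp
qed

section \<open>Regions whose horizontal slices are intervals\<close>

text \<open>Heights that miss the region are encoded by a nonpositive \<open>w\<close>, which makes
  the slice empty.\<close>

definition sheared :: "(real \<Rightarrow> real) \<Rightarrow> (real \<Rightarrow> real) \<Rightarrow> real \<Rightarrow> (real \<times> real) set" where
  "sheared m w s = {z. \<bar>fst z - s * m (snd z)\<bar> < w (snd z)}"

lemma sheared_measurable [measurable]:
  assumes [measurable]: "m \<in> borel_measurable borel" "w \<in> borel_measurable borel"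
  shows "sheared m w s \<in> sets borel"
proof -
  have "{z \<in> space (borel \<Otimes>\<^sub>M borel). \<bar>fst z - s * m (snd z)\<bar> < w (snd z)} \<in> sets (borel \<Otimes>\<^sub>M borel)"
    by measurable
  then show ?thesis by (simp add: sheared_def borel_prod[symmetric] space_pair_measure)
qed

lemma indicator_sheared:
  "indicator (sheared m w s) (x, y) = indicator {s * m y - w y<..<s * m y + w y} x"
  by (auto simp: sheared_def indicator_def abs_less_iff)

text \<open>The right-hand side is free of \<open>s\<close>: shearing preserves area. Slices with
  negative \<open>w\<close> are empty, in agreement with the truncation by
  \<open>ennreal\<close>.\<close>

lemma emeasure_sheared:
  assumes [measurable]: "m \<in> borel_measurable borel" "w \<in> borel_measurable borel"
  shows "emeasure lborel (sheared m w s) = (\<integral>\<^sup>+y. ennreal (2 * w y) \<partial>lborel)"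
proof -
  have "emeasure lborel (sheared m w s) = (\<integral>\<^sup>+z. indicator (sheared m w s) z \<partial>lborel)"
    by simp
  also have "\<dots> = (\<integral>\<^sup>+y. \<integral>\<^sup>+x. indicator {s * m y - w y<..<s * m y + w y} x \<partial>lborel \<partial>lborel)"
    by (subst nn_integral_plane) (auto simp: indicator_sheared)
  also have "\<dots> = (\<integral>\<^sup>+y. ennreal (2 * w y) \<partial>lborel)"
  proof (rule nn_integral_cong)
    fix y
    show "(\<integral>\<^sup>+x. indicator {s * m y - w y<..<s * m y + w y} x \<partial>lborel) = ennreal (2 * w y)"
      by (cases "0 \<le> w y") (auto simp: ennreal_neg)
  qed
  finally show ?thesis .
qed

section \<open>Strict decrease of the energy under shearing, for positive kernels\<close>

definition nn_energy :: "(real \<Rightarrow> real) \<Rightarrow> (real \<times> real) set \<Rightarrow> ennreal" where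
  "nn_energy L \<Omega> = (\<integral>\<^sup>+z'. \<integral>\<^sup>+z. ennreal (L (norm (z - z'))) * indicator \<Omega> z * indicator \<Omega> z' \<partial>lborel \<partial>lborel)"

text \<open>The value 0 for \<open>r \<le> 0\<close> makes \<open>L\<close> Borel measurable on the
  whole line and settles the diagonal.\<close>

locale positive_kernel =
  fixes L :: "real \<Rightarrow> real"
  assumes continuous: "continuous_on {0<..} L"
    and positive: "0 < r \<Longrightarrow> 0 < L r"
    and nonpositive_arg: "r \<le> 0 \<Longrightarrow> L r = 0"
    and decreasing: "0 < r \<Longrightarrow> r < r' \<Longrightarrow> L r' < L r"
begin

lemma kernel_measurable [measurable]: "L \<in> borel_measurable borel"
proof -
  have "(\<lambda>r. indicator {0<..} r *\<^sub>R L r) \<in> borel_measurable borel"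
    by (rule borel_measurable_continuous_on_indicator) (auto simp: continuous)
  also have "(\<lambda>r. indicator {0<..} r *\<^sub>R L r) = L"
    using nonpositive_arg by (auto simp: fun_eq_iff indicator_def)
  finally show ?thesis .
qed

text \<open>At height difference \<open>h \<noteq> 0\<close> the norm stays positive, so a
  singularity of \<open>L\<close> at 0 is never met.\<close>

lemma bump_section:
  fixes h :: real
  assumes "h \<noteq> 0"
  shows "bump (\<lambda>x. L (norm (x, h)))"
proof (rule bumpI)
  have n: "norm (x, h) > 0" for x :: real using assms by (simp add: zero_prod_def)
  show "continuous_on UNIV (\<lambda>x::real. L (norm (x, h)))"
    by (rule continuous_on_compose2[OF continuous]) (use n in \<open>auto intro!: continuous_intros simp del: zero_less_norm_iff\<close>)
  show "0 < L (norm (x, h))" for x :: real using positive n by blast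
  show "L (norm (- x, h)) = L (norm (x, h))" for x :: real by (simp add: norm_Pair)
  show "L (norm (y, h)) < L (norm (x, h))" if "0 \<le> x" "x < y" for x y :: real
    using that by (intro decreasing n) (auto simp: norm_Pair real_norm_def intro!: power_strict_mono)
qed

text \<open>Two successive window averages: over the slice of \<open>x\<close> with half-length
  \<open>p\<close>, then over that of \<open>x'\<close> with half-length \<open>q\<close>.\<close>

lemma slice_profile:
  fixes y y' p q :: real
  assumes "y \<noteq> y'" and p: "p > 0" and q: "q > 0"
  obtains g where "bump g"
    "\<And>c c'. (\<integral>\<^sup>+x'. \<integral>\<^sup>+x. ennreal (L (norm (x - x', y - y'))) *
        indicator {c - p<..<c + p} x * indicator {c' - q<..<c' + q} x' \<partial>lborel \<partial>lborel) = ennreal (g (c - c'))"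
proof -
  obtain k where k: "bump k" and k_eq: "\<And>b c. (\<integral>\<^sup>+x. ennreal (L (norm (x - b, y - y'))) *
        indicator {c - p<..<c + p} x \<partial>lborel) = ennreal (k (c - b))"
    using bump_window[OF bump_section[of "y - y'"] p] assms(1) by auto
  obtain g where g: "bump g" and g_eq: "\<And>b c. (\<integral>\<^sup>+x. ennreal (k (x - b)) *
        indicator {c - q<..<c + q} x \<partial>lborel) = ennreal (g (c - b))"
    using bump_window[OF k q] by blast
  have even: "f (x - x') = f (x' - x)" if "bump f" for f x x'
    using that unfolding bump_def by (metis minus_diff_eq)
  have [measurable]: "(\<lambda>x. L (norm (x - b, y - y'))) \<in> borel_measurable borel" for b :: real
    unfolding norm_Pair by measurable
  show ?thesis
  proof (rule that[OF g])
    fix c c'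
    show "(\<integral>\<^sup>+x'. \<integral>\<^sup>+x. ennreal (L (norm (x - x', y - y'))) *
        indicator {c - p<..<c + p} x * indicator {c' - q<..<c' + q} x' \<partial>lborel \<partial>lborel) = ennreal (g (c - c'))"
      \<comment> \<open>The inner integral is \<open>k (c - x')\<close>; evenness turns it into
        \<open>k (x' - c)\<close>, the form to which the second average applies.\<close>
      by (subst nn_integral_multc) (simp_all add: k_eq even[OF k, of c] g_eq even[OF g, of c])
  qed
qed

text \<open>The slice interactions are compared pointwise in the pair of heights:
  \<open>\<le>\<close> off the diagonal, \<open><\<close> off the diagonal of the square over
  \<open>{c<..<d}\<close>. Finiteness of the smaller energy lets strictness pass to the
  integrals.\<close>

lemma nn_energy_sheared_less:
  assumes [measurable]: "m \<in> borel_measurable borel" "w \<in> borel_measurable borel"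
    and ss': "\<bar>s\<bar> < \<bar>s'\<bar>"
    and fin: "nn_energy L (sheared m w s') \<noteq> \<infinity>"
    and cd: "c < d" and w: "\<And>y. y \<in> {c<..<d} \<Longrightarrow> w y > 0" and inj: "inj_on m {c<..<d}"
  shows "nn_energy L (sheared m w s') < nn_energy L (sheared m w s)"
proof -
  define P where "P s = (\<lambda>(y', y). \<integral>\<^sup>+x'. \<integral>\<^sup>+x. ennreal (L (norm ((x, y) - (x', y')))) *
    indicator (sheared m w s) (x, y) * indicator (sheared m w s) (x', y') \<partial>lborel \<partial>lborel)" for s
  have [measurable]: "P s \<in> borel_measurable (lborel \<Otimes>\<^sub>M lborel)" for s
    unfolding P_def by measurable
  have energy_P: "nn_energy L (sheared m w s) = (\<integral>\<^sup>+z. P s z \<partial>(lborel \<Otimes>\<^sub>M lborel))" for s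
    by (subst lborel.nn_integral_fst[symmetric])
      (auto simp: nn_energy_def nn_integral_two_planes P_def)
  have P_zero: "P s (y', y) = 0" if "w y \<le> 0 \<or> w y' \<le> 0" for s y y'
  proof -
    have "indicator (sheared m w s) (x, y) * indicator (sheared m w s) (x', y') = (0 :: ennreal)" for x x'
      using that by (auto simp: sheared_def indicator_def)
    then show ?thesis by (simp add: P_def mult.assoc del: mult_eq_0_iff)
  qed
  have P_profile: "\<exists>g. bump g \<and> (\<forall>s. P s (y', y) = ennreal (g (s * (m y - m y'))))"
    if yy': "y \<noteq> y'" and w: "w y > 0" "w y' > 0" for y y'
  proof -
    obtain g where g: "bump g" and eq: "\<And>c c'. (\<integral>\<^sup>+x'. \<integral>\<^sup>+x. ennreal (L (norm (x - x', y - y'))) *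
        indicator {c - w y<..<c + w y} x * indicator {c' - w y'<..<c' + w y'} x' \<partial>lborel \<partial>lborel) = ennreal (g (c - c'))"
      using slice_profile[OF yy' w] by blast
    have "P s (y', y) = ennreal (g (s * (m y - m y')))" for s
      by (simp add: P_def indicator_sheared eq right_diff_distrib)
    with g show ?thesis by blast
  qed
  have P_le: "P s' (y', y) \<le> P s (y', y)" if yy': "y \<noteq> y'" for y y'
  proof (cases "w y > 0 \<and> w y' > 0")
    case True
    then obtain g where g: "bump g" "\<And>s. P s (y', y) = ennreal (g (s * (m y - m y')))"
      using P_profile[OF yy'] by blast
    have "g (s' * (m y - m y')) \<le> g (s * (m y - m y'))"
    proof (cases "m y = m y'")
      case False
      then have "\<bar>s * (m y - m y')\<bar> < \<bar>s' * (m y - m y')\<bar>"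
        using ss' by (simp add: abs_mult)
      then show ?thesis using g(1) unfolding bump_def by (meson less_imp_le)
    qed simp
    then show ?thesis by (simp add: g(2) ennreal_leI)
  qed (use P_zero[of y y'] in \<open>auto simp: not_less\<close>)
  have P_less: "P s' (y', y) < P s (y', y)" if yy': "y \<noteq> y'" "y \<in> {c<..<d}" "y' \<in> {c<..<d}" for y y'
  proof -
    obtain g where g: "bump g" "\<And>s. P s (y', y) = ennreal (g (s * (m y - m y')))"
      using P_profile[OF yy'(1)] w yy' by blast
    have "m y \<noteq> m y'" using inj yy' by (auto dest: inj_onD)
    then have "\<bar>s * (m y - m y')\<bar> < \<bar>s' * (m y - m y')\<bar>"
      using ss' by (simp add: abs_mult)
    \<comment> \<open>The second fact is what \<open>ennreal_lessI\<close> requires besides the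
      inequality itself.\<close>
    then have "g (s' * (m y - m y')) < g (s * (m y - m y'))" "0 < g (s * (m y - m y'))"
      using g(1) unfolding bump_def by blast+
    then show ?thesis by (simp add: g(2) ennreal_lessI)
  qed
  \<comment> \<open>Equal heights, for which there is no continuous profile, form a null
    set.\<close>
  have ne: "AE z in lborel \<Otimes>\<^sub>M lborel. fst z \<noteq> (snd z :: real)"
  proof (rule lborel_pair.AE_pair_measure)
    show "AE x in lborel. AE y in lborel. fst (x, y) \<noteq> (snd (x, y) :: real)"
    proof (rule AE_I2)
      show "AE y in lborel. fst (x, y) \<noteq> (snd (x, y) :: real)" for x
        using AE_lborel_singleton[of x] by (simp add: eq_commute)
    qed
  qed measurable
  show ?thesis
    unfolding energy_P
  proof (rule nn_integral_less)
    show "(\<integral>\<^sup>+z. P s' z \<partial>(lborel \<Otimes>\<^sub>M lborel)) \<noteq> \<infinity>" using fin by (simp add: energy_P)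
    show "AE z in lborel \<Otimes>\<^sub>M lborel. P s' z \<le> P s z"
      using ne P_le by (auto elim!: eventually_mono)
    \<comment> \<open>Otherwise the square over \<open>{c<..<d}\<close> would be a null set,
      although its sides have length \<open>d - c > 0\<close>.\<close>
    show "\<not> (AE z in lborel \<Otimes>\<^sub>M lborel. P s z \<le> P s' z)"
    proof
      assume "AE z in lborel \<Otimes>\<^sub>M lborel. P s z \<le> P s' z"
      with ne have "AE z in lborel \<Otimes>\<^sub>M lborel. z \<notin> {c<..<d} \<times> {c<..<d}"
      proof eventually_elim
        case (elim z)
        then show ?case using P_less by (cases z) (force simp: not_less[symmetric])
      qed
      then have "emeasure (lborel \<Otimes>\<^sub>M lborel) ({c<..<d} \<times> {c<..<d}) = 0"
        by (subst (asm) AE_iff_measurable[OF _ refl])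
          (auto simp: space_pair_measure)
      then show False using cd
        by (simp add: lborel.emeasure_pair_measure_Times)
    qed
  qed measurable
qed

section \<open>Finiteness of the energy\<close>

lemma potential_bounded:
  fixes \<Omega> :: "(real \<times> real) set"
  assumes fin: "(\<integral>\<^sup>+r. ennreal (r * L r) * indicator {0<..<1} r \<partial>lborel) < \<infinity>"
    and [measurable]: "\<Omega> \<in> sets borel" and \<Omega>: "emeasure lborel \<Omega> < \<infinity>"
  obtains C where "C < \<infinity>"
    "\<And>z'. (\<integral>\<^sup>+z. ennreal (L (norm (z - z'))) * indicator \<Omega> z \<partial>lborel) \<le> (C :: ennreal)"
proof -
  \<comment> \<open>Since \<open>L\<close> decreases, \<open>L \<bar>z\<bar>\<close> is at most \<open>L\<close> of the maximum norm of \<open>z\<close>: this avoids polar coordinates.\<close>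
  define A :: "real \<Rightarrow> real \<Rightarrow> ennreal" where
    "A x y = ennreal (L \<bar>x\<bar>) * indicator {-1<..<1} x * indicator {-\<bar>x\<bar>..\<bar>x\<bar>} y" for x y
  define B where "B z = A (fst z) (snd z) + A (snd z) (fst z)" for z
  have A_if: "A = (\<lambda>x y. if x \<in> {-1<..<1} \<and> \<bar>y\<bar> \<le> \<bar>x\<bar> then ennreal (L \<bar>x\<bar>) else 0)"
    by (auto simp: A_def abs_le_iff fun_eq_iff)
  have [measurable (raw)]: "(\<lambda>z. A (f z) (g z)) \<in> borel_measurable N"
    if "f \<in> borel_measurable N" "g \<in> borel_measurable N" for f g and N :: "real measure"
    using that unfolding A_if by measurable
  have [measurable (raw)]: "(\<lambda>z. A (f z) (g z)) \<in> borel_measurable N"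
    if "f \<in> borel_measurable N" "g \<in> borel_measurable N" for f g and N :: "(real \<times> real) measure"
    using that unfolding A_if by measurable
  have [measurable]: "B \<in> borel_measurable borel"
    unfolding B_def borel_prod[symmetric] by measurable
  define J where "J = (\<integral>\<^sup>+x. ennreal (x * L x) * indicator {0<..<1} x \<partial>lborel)"
  \<comment> \<open>Integrating over \<open>y\<close> produces the factor
    \<open>2 * \<bar>x\<bar>\<close>; the positive and the negative \<open>x\<close> then contribute
    \<open>2 * J\<close> each.\<close>
  have A_int: "(\<integral>\<^sup>+x. \<integral>\<^sup>+y. A x y \<partial>lborel \<partial>lborel) \<le> 2 * J + 2 * J"
  proof -
    have "(\<integral>\<^sup>+y. A x y \<partial>lborel) \<le> 2 * (ennreal (x * L x) * indicator {0<..<1} x)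
        + 2 * (ennreal (- x * L (- x)) * indicator {0<..<1} (- x))" for x
    proof -
      have "(\<integral>\<^sup>+y. A x y \<partial>lborel) = ennreal (L \<bar>x\<bar>) * indicator {-1<..<1} x * ennreal (2 * \<bar>x\<bar>)"
        unfolding A_def by (subst nn_integral_cmult) auto
      also have "\<dots> = ennreal (2 * (\<bar>x\<bar> * L \<bar>x\<bar>)) * indicator {-1<..<1} x"
        by (simp add: ennreal_mult'' [symmetric] indicator_def mult_ac)
      also have "\<dots> \<le> 2 * (ennreal (x * L x) * indicator {0<..<1} x)
        + 2 * (ennreal (- x * L (- x)) * indicator {0<..<1} (- x))"
        using ennreal_mult'[of 2 "x * L x"] ennreal_mult'[of 2 "- (x * L (- x))"]
        by (cases x "0 :: real" rule: linorder_cases) (auto simp: indicator_def)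
      finally show ?thesis .
    qed
    then have "(\<integral>\<^sup>+x. \<integral>\<^sup>+y. A x y \<partial>lborel \<partial>lborel)
        \<le> (\<integral>\<^sup>+x. 2 * (ennreal (x * L x) * indicator {0<..<1} x)
        + 2 * (ennreal (- x * L (- x)) * indicator {0<..<1} (- x)) \<partial>lborel)"
      by (intro nn_integral_mono)
    also have "\<dots> = 2 * J + 2 * (\<integral>\<^sup>+x. ennreal (- x * L (- x)) * indicator {0<..<1} (- x) \<partial>lborel)"
      by (simp add: nn_integral_add nn_integral_cmult J_def)
    also have "(\<integral>\<^sup>+x. ennreal (- x * L (- x)) * indicator {0<..<1} (- x) \<partial>lborel) = J"
      unfolding J_def by (subst nn_integral_real_affine[where c = "-1" and t = 0]) simp_all
    finally show ?thesis .
  qed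
  have B_int: "(\<integral>\<^sup>+z. B z \<partial>lborel) \<le> 2 * J + 2 * J + (2 * J + 2 * J)"
  proof -
    have "(\<integral>\<^sup>+z. B z \<partial>lborel) = (\<integral>\<^sup>+y. \<integral>\<^sup>+x. A x y \<partial>lborel \<partial>lborel) + (\<integral>\<^sup>+y. \<integral>\<^sup>+x. A y x \<partial>lborel \<partial>lborel)"
      by (subst nn_integral_plane) (simp_all add: B_def nn_integral_add)
    also have "(\<integral>\<^sup>+y. \<integral>\<^sup>+x. A x y \<partial>lborel \<partial>lborel) = (\<integral>\<^sup>+x. \<integral>\<^sup>+y. A x y \<partial>lborel \<partial>lborel)"
      by (rule lborel_pair.Fubini') measurable
    finally show ?thesis using A_int by (simp add: add_mono)
  qed
  have L_le: "ennreal (L (norm z)) \<le> ennreal (L 1) + B z" for z :: "real \<times> real"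
  proof -
    have anti: "L r' \<le> L r" if "0 < r" "r \<le> r'" for r r'
      using decreasing[of r r'] that by (cases "r = r'") auto
    \<comment> \<open>Here \<open>u\<close> is the coordinate of larger modulus. If it is 0, then
      \<open>z = 0\<close> and \<open>L\<close> vanishes; below 1 the term \<open>A u v\<close>
      dominates, and from 1 on the constant \<open>L 1\<close> does.\<close>
    have key: "ennreal (L (norm z)) \<le> ennreal (L 1) + A u v"
      if u: "\<bar>v\<bar> \<le> \<bar>u\<bar>" "\<bar>u\<bar> \<le> norm z" "\<bar>u\<bar> = 0 \<Longrightarrow> norm z = 0" for u v
    proof -
      consider "u = 0" | "\<bar>u\<bar> < 1" "u \<noteq> 0" | "1 \<le> \<bar>u\<bar>" by linarith
      then show ?thesis
      proof cases
        case 1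
        then show ?thesis using u(3) by (simp add: nonpositive_arg)
      next
        case 2
        then have "A u v = ennreal (L \<bar>u\<bar>)" using u(1) by (auto simp: A_if)
        moreover have "L (norm z) \<le> L \<bar>u\<bar>" using 2 u(2) by (intro anti) auto
        ultimately show ?thesis by (simp add: ennreal_leI add_increasing)
      next
        case 3
        then have "L (norm z) \<le> L 1" using u(2) by (intro anti) auto
        then show ?thesis by (simp add: ennreal_leI add_increasing2)
      qed
    qed
    obtain x y where z: "z = (x, y)" by (cases z)
    have "\<bar>x\<bar> \<le> norm z" "\<bar>y\<bar> \<le> norm z"
      using norm_fst_le[of x y] norm_snd_le[of y x] by (simp_all add: z)
    then have "ennreal (L (norm z)) \<le> ennreal (L 1) + A x y \<or> ennreal (L (norm z)) \<le> ennreal (L 1) + A y x"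
      using key[of y x] key[of x y] by (cases "\<bar>y\<bar> \<le> \<bar>x\<bar>") (auto simp: z norm_Pair)
    moreover have "A x y \<le> B z" "A y x \<le> B z" by (simp_all add: B_def z)
    ultimately show ?thesis by (meson add_left_mono order_trans)
  qed
  show ?thesis
  proof (rule that)
    \<comment> \<open>Translation invariance of the integral of \<open>B\<close> makes this bound
      independent of \<open>z'\<close>.\<close>
    let ?C = "ennreal (L 1) * emeasure lborel \<Omega> + (\<integral>\<^sup>+z. B z \<partial>lborel)"
    have "2 * J + 2 * J + (2 * J + 2 * J) < \<infinity>"
      using fin by (simp add: J_def[symmetric] ennreal_mult_less_top)
    then have "(\<integral>\<^sup>+z. B z \<partial>lborel) < \<infinity>"
      using B_int by (rule le_less_trans[rotated])
    then show "?C < \<infinity>" using \<Omega> by (simp add: ennreal_mult_less_top)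
    show "(\<integral>\<^sup>+z. ennreal (L (norm (z - z'))) * indicator \<Omega> z \<partial>lborel) \<le> ?C" for z' :: "real \<times> real"
    proof -
      have "(\<integral>\<^sup>+z. ennreal (L (norm (z - z'))) * indicator \<Omega> z \<partial>lborel)
          \<le> (\<integral>\<^sup>+z. ennreal (L 1) * indicator \<Omega> z + B (z - z') \<partial>lborel)"
      proof (rule nn_integral_mono)
        fix z
        show "ennreal (L (norm (z - z'))) * indicator \<Omega> z \<le> ennreal (L 1) * indicator \<Omega> z + B (z - z')"
          using L_le[of "z - z'"] by (auto simp: indicator_def)
      qed
      also have "\<dots> = ?C"
        by (simp add: nn_integral_add nn_integral_cmult_indicator nn_integral_lborel_translate)
      finally show ?thesis .
    qed
  qed
qed

lemma nn_energy_finite: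
  assumes fin: "(\<integral>\<^sup>+r. ennreal (r * L r) * indicator {0<..<1} r \<partial>lborel) < \<infinity>"
    and [measurable]: "\<Omega> \<in> sets borel" and \<Omega>: "emeasure lborel \<Omega> < \<infinity>"
  shows "nn_energy L \<Omega> < \<infinity>"
proof -
  obtain C where C: "C < \<infinity>"
    "\<And>z'. (\<integral>\<^sup>+z. ennreal (L (norm (z - z'))) * indicator \<Omega> z \<partial>lborel) \<le> C"
    using potential_bounded[OF assms] by blast
  have "nn_energy L \<Omega> = (\<integral>\<^sup>+z'. (\<integral>\<^sup>+z. ennreal (L (norm (z - z'))) * indicator \<Omega> z \<partial>lborel) * indicator \<Omega> z' \<partial>lborel)"
    unfolding nn_energy_def by (subst nn_integral_multc) auto
  also have "\<dots> \<le> (\<integral>\<^sup>+z'. C * indicator \<Omega> z' \<partial>lborel)"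
    using C by (intro nn_integral_mono mult_right_mono) auto
  also have "\<dots> = C * emeasure lborel \<Omega>"
    by (simp add: nn_integral_cmult_indicator)
  also have "\<dots> < \<infinity>" using C \<Omega> by (simp add: ennreal_mult_less_top)
  finally show ?thesis .
qed

section \<open>From the extended nonnegative energy to the real one\<close>

text \<open>Bochner integrals default to 0, so integrability must be shown at both levels: the
  bounded potential gives the inner one, the finite energy the outer one. Integrating
  \<open>c\<close> twice over \<open>\<Omega>\<close> yields the squared area.\<close>

lemma energy_eq_nn_energy:
  assumes fin: "(\<integral>\<^sup>+r. ennreal (r * L r) * indicator {0<..<1} r \<partial>lborel) < \<infinity>"
    and [measurable]: "\<Omega> \<in> sets borel" and \<Omega>: "emeasure lborel \<Omega> < \<infinity>"
    and diam: "\<And>z z'. z \<in> \<Omega> \<Longrightarrow> z' \<in> \<Omega> \<Longrightarrow> norm (z - z') < M"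
    and K: "\<And>r. 0 < r \<Longrightarrow> r < M \<Longrightarrow> K r = L r + c"
  shows "energy K \<Omega> = enn2real (nn_energy L \<Omega>) + c * (measure lborel \<Omega>)\<^sup>2"
proof -
  have L_nonneg: "0 \<le> L r" for r
    using positive[of r] nonpositive_arg[of r] by (cases "r \<le> 0") auto
  define V where "V z' = (\<integral>\<^sup>+z. ennreal (L (norm (z - z'))) * indicator \<Omega> z \<partial>lborel)" for z'
  have [measurable]: "V \<in> borel_measurable borel" unfolding V_def by measurable
  obtain C where C: "C < \<infinity>" "\<And>z'. V z' \<le> C"
    using potential_bounded[OF assms(1-3)] unfolding V_def by blast
  have V_fin: "V z' < \<infinity>" for z' using C by (meson le_less_trans)
  have int_\<Omega>: "integrable lborel (indicator \<Omega> :: real \<times> real \<Rightarrow> real)"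
    using \<Omega> by simp
  have inner: "(LINT z:\<Omega>|lborel. K (norm (z - z'))) = enn2real (V z') + c * measure lborel \<Omega>"
    if z': "z' \<in> \<Omega>" for z'
  proof -
    have V: "V z' = (\<integral>\<^sup>+z. ennreal (indicator \<Omega> z * L (norm (z - z'))) \<partial>lborel)"
      unfolding V_def by (intro nn_integral_cong) (auto simp: indicator_def)
    have int: "integrable lborel (\<lambda>z. indicator \<Omega> z * L (norm (z - z')))"
      by (rule integrableI_nonneg) (use V_fin[of z', unfolded V] L_nonneg in auto)
    have eqV: "(LINT z|lborel. indicator \<Omega> z * L (norm (z - z'))) = enn2real (V z')"
      unfolding V by (rule integral_eq_nn_integral) (auto simp: L_nonneg)
    have "(LINT z:\<Omega>|lborel. K (norm (z - z')))
        = (LINT z|lborel. indicator \<Omega> z * L (norm (z - z')) + c * indicator \<Omega> z)"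
      unfolding set_lebesgue_integral_def
    proof (rule integral_cong_AE)
      show ae: "AE z in lborel. indicator \<Omega> z *\<^sub>R K (norm (z - z')) = indicator \<Omega> z * L (norm (z - z')) + c * indicator \<Omega> z"
        using AE_lborel_singleton[of z']
        by eventually_elim (use diam z' K in \<open>auto simp: indicator_def\<close>)
      show "(\<lambda>z. indicator \<Omega> z *\<^sub>R K (norm (z - z'))) \<in> borel_measurable lborel"
      proof -
        \<comment> \<open>Measurability of \<open>K\<close> is inherited from \<open>L\<close> for
          distances in \<open>(0, M)\<close>; the value \<open>K 0\<close> enters only at the point
          \<open>z'\<close>.\<close>
        have "(\<lambda>z. if z = z' then K 0 else indicator \<Omega> z * L (norm (z - z')) + c * indicator \<Omega> z) \<in> borel_measurable borel"
          by measurable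
        also have "(\<lambda>z. if z = z' then K 0 else indicator \<Omega> z * L (norm (z - z')) + c * indicator \<Omega> z)
            = (\<lambda>z. indicator \<Omega> z *\<^sub>R K (norm (z - z')))"
          using diam z' K by (auto simp: fun_eq_iff indicator_def)
        finally show ?thesis by simp
      qed
    qed measurable
    also have "\<dots> = enn2real (V z') + c * measure lborel \<Omega>"
      using int int_\<Omega> by (simp add: eqV)
    finally show ?thesis .
  qed
  have E: "nn_energy L \<Omega> = (\<integral>\<^sup>+z'. ennreal (indicator \<Omega> z' * enn2real (V z')) \<partial>lborel)"
  proof -
    have "nn_energy L \<Omega> = (\<integral>\<^sup>+z'. V z' * indicator \<Omega> z' \<partial>lborel)"
      unfolding nn_energy_def V_def by (subst nn_integral_multc) auto
    also have "\<dots> = (\<integral>\<^sup>+z'. ennreal (indicator \<Omega> z' * enn2real (V z')) \<partial>lborel)"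
      using V_fin by (intro nn_integral_cong) (auto simp: indicator_def)
    finally show ?thesis .
  qed
  have int: "integrable lborel (\<lambda>z'. indicator \<Omega> z' * enn2real (V z'))"
    by (rule integrableI_nonneg) (use nn_energy_finite[OF assms(1-3)] E in auto)
  have eqE: "(LINT z'|lborel. indicator \<Omega> z' * enn2real (V z')) = enn2real (nn_energy L \<Omega>)"
    unfolding E by (rule integral_eq_nn_integral) auto
  have "energy K \<Omega> = (LINT z'|lborel. indicator \<Omega> z' * enn2real (V z') + c * measure lborel \<Omega> * indicator \<Omega> z')"
    unfolding energy_def set_lebesgue_integral_def[of _ _ "\<lambda>z'. LINT z:\<Omega>|lborel. K (norm (z - z'))"]
    by (rule Bochner_Integration.integral_cong) (auto simp: indicator_def inner)
  also have "\<dots> = enn2real (nn_energy L \<Omega>) + c * (measure lborel \<Omega>)\<^sup>2"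
    using int int_\<Omega> by (simp add: eqE power2_eq_square)
  finally show ?thesis .
qed

end

section \<open>The region enclosed by the polygon\<close>

text \<open>A component of \<open>- S\<close> that meets \<open>R\<close> cannot reach
  \<open>U\<close>, so it is bounded; one that meets \<open>U\<close> contains a ray, so it is
  unbounded. This avoids the Jordan curve theorem.\<close>

lemma inside_eqI:
  fixes S :: "'a::real_normed_vector set"
  assumes "open R" "open U" "R \<inter> U = {}" and S: "- S = R \<union> U" and "bounded R"
    and ray: "\<And>z. z \<in> U \<Longrightarrow> \<exists>v. v \<noteq> 0 \<and> (\<forall>t\<ge>0. z + t *\<^sub>R v \<in> U)"
  shows "inside S = R"
proof (intro set_eqI iffI)
  fix z assume z: "z \<in> R"
  let ?C = "connected_component_set (- S) z"
  have "z \<in> ?C" using z S by auto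
  moreover have "connected ?C" by simp
  moreover have "?C \<subseteq> R \<union> U" using connected_component_subset[of "- S" z] S by simp
  ultimately have "?C \<subseteq> R"
    using connectedD[of ?C R U] assms(1-3) z by blast
  then show "z \<in> inside S"
    using z S \<open>bounded R\<close> bounded_subset unfolding inside_def by auto
next
  fix z assume z: "z \<in> inside S"
  then have "z \<in> R \<union> U" using S unfolding inside_def by auto
  moreover have "z \<notin> U"
  proof
    assume "z \<in> U"
    then obtain v where v: "v \<noteq> 0" "\<And>t. t \<ge> 0 \<Longrightarrow> z + t *\<^sub>R v \<in> U" using ray by blast
    have "connected ((\<lambda>t. z + t *\<^sub>R v) ` {0..})"
      by (intro connected_continuous_image continuous_intros) simp
    moreover have "z \<in> (\<lambda>t. z + t *\<^sub>R v) ` {0..}" by (rule image_eqI[of _ _ 0]) auto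
    moreover have "(\<lambda>t. z + t *\<^sub>R v) ` {0..} \<subseteq> - S" using v S by auto
    ultimately have "(\<lambda>t. z + t *\<^sub>R v) ` {0..} \<subseteq> connected_component_set (- S) z"
      by (intro connected_component_maximal)
    moreover have "bounded (connected_component_set (- S) z)" using z by (simp add: inside_def)
    ultimately have "bounded ((\<lambda>t. z + t *\<^sub>R v) ` {0..})" by (rule bounded_subset[rotated])
    then obtain B where B: "\<And>t. t \<ge> 0 \<Longrightarrow> norm (z + t *\<^sub>R v) \<le> B"
      unfolding bounded_iff by auto
    then have "0 \<le> B" using norm_ge_zero order_trans by blast
    \<comment> \<open>Chosen so that \<open>t *\<^sub>R v\<close> is longer than the triangle
      inequality allows, namely \<open>B + norm z\<close>.\<close>
    define t where "t = (B + norm z + 1) / norm v"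
    have t: "t \<ge> 0" using \<open>0 \<le> B\<close> by (simp add: t_def)
    have "norm (t *\<^sub>R v) = B + norm z + 1" using v \<open>0 \<le> B\<close> by (simp add: t_def)
    moreover have "norm (t *\<^sub>R v) \<le> norm (z + t *\<^sub>R v) + norm z"
      using norm_triangle_ineq4[of "z + t *\<^sub>R v" z] by simp
    ultimately show False using B[OF t] by simp
  qed
  ultimately show "z \<in> R" by blast
qed

text \<open>At height \<open>y\<close>, the left and the right side of the quadrilateral both have barycentric weight
  \<open>weight yA y\<close> at \<open>A\<close> and \<open>weight yC y\<close> at \<open>C\<close>. As \<open>yA\<close> and \<open>yC\<close> have opposite signs, at most one of
  the two is nonzero.\<close>

definition weight :: "real \<Rightarrow> real \<Rightarrow> real" where
  "weight Y y = max 0 (y / Y)"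

definition midline :: "real \<Rightarrow> real \<Rightarrow> real \<Rightarrow> real \<Rightarrow> real \<Rightarrow> real" where
  "midline xA yA xC yC y = xA * weight yA y + xC * weight yC y"

text \<open>Beyond the heights \<open>yA\<close> and \<open>yC\<close> one weight exceeds 1, so the
  value is negative and the slice empty.\<close>

definition halfwidth :: "real \<Rightarrow> real \<Rightarrow> real \<Rightarrow> real \<Rightarrow> real" where
  "halfwidth a yA yC y = a * (1 - weight yA y - weight yC y)"

lemma continuous_on_weight [continuous_intros]:
  "continuous_on S f \<Longrightarrow> continuous_on S (\<lambda>x. weight Y (f x))"
  unfolding weight_def divide_inverse by (intro continuous_intros)

lemma weight_measurable [measurable]: "weight Y \<in> borel_measurable borel"
  unfolding weight_def by measurable

lemma midline_measurable [measurable]: "midline xA yA xC yC \<in> borel_measurable borel"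
  unfolding midline_def by measurable

lemma halfwidth_measurable [measurable]: "halfwidth a yA yC \<in> borel_measurable borel"
  unfolding halfwidth_def by measurable

lemma closed_segment_to_axis:
  fixes X Y b :: real
  assumes "Y \<noteq> 0"
  shows "(x, y) \<in> closed_segment (X, Y) (b, 0) \<longleftrightarrow>
    0 \<le> y / Y \<and> y / Y \<le> 1 \<and> x = X * (y / Y) + b * (1 - y / Y)"
proof
  assume "(x, y) \<in> closed_segment (X, Y) (b, 0)"
  then obtain u where u: "0 \<le> u" "u \<le> 1" "x = (1 - u) * X + u * b" "y = (1 - u) * Y"
    by (auto simp: in_segment)
  then have "y / Y = 1 - u" using assms by simp
  with u show "0 \<le> y / Y \<and> y / Y \<le> 1 \<and> x = X * (y / Y) + b * (1 - y / Y)"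
    by (simp add: mult.commute)
next
  assume "0 \<le> y / Y \<and> y / Y \<le> 1 \<and> x = X * (y / Y) + b * (1 - y / Y)"
  then show "(x, y) \<in> closed_segment (X, Y) (b, 0)"
    unfolding in_segment using assms
    by (intro exI[of _ "1 - y / Y"]) (simp add: algebra_simps)
qed

text \<open>At each height the two sides sit symmetrically about the midline. The height range is
  implicit: a modulus is nonnegative, which keeps the weights at most 1.\<close>

lemma sides_iff:
  fixes a xA xC yA yC s :: real
  assumes a: "a > 0" and y: "yA * yC < 0"
  shows "(x, y) \<in> closed_segment (xA * s, yA) (a, 0) \<union> closed_segment (a, 0) (xC * s, yC) \<union>
      closed_segment (xC * s, yC) (-a, 0) \<union> closed_segment (-a, 0) (xA * s, yA)
    \<longleftrightarrow> \<bar>x - s * midline xA yA xC yC y\<bar> = halfwidth a yA yC y"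
proof -
  have Y: "yA \<noteq> 0" "yC \<noteq> 0" using y by auto
  define p q where "p = y / yA" and "q = y / yC"
  have "(x, y) \<in> closed_segment (xA * s, yA) (a, 0) \<union> closed_segment (a, 0) (xC * s, yC) \<union>
      closed_segment (xC * s, yC) (-a, 0) \<union> closed_segment (-a, 0) (xA * s, yA)
    \<longleftrightarrow> 0 \<le> p \<and> p \<le> 1 \<and> (x = xA * s * p + a * (1 - p) \<or> x = xA * s * p + (- a) * (1 - p)) \<or>
      0 \<le> q \<and> q \<le> 1 \<and> (x = xC * s * q + a * (1 - q) \<or> x = xC * s * q + (- a) * (1 - q))"
    unfolding Un_iff closed_segment_commute[of "(a, 0)"] closed_segment_commute[of "(- a, 0)"]
      closed_segment_to_axis[OF Y(1)] closed_segment_to_axis[OF Y(2)] p_def[symmetric] q_def[symmetric]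
    by blast
  also have "\<dots> \<longleftrightarrow> 0 \<le> p \<and> \<bar>x - xA * s * p\<bar> = a * (1 - p) \<or> 0 \<le> q \<and> \<bar>x - xC * s * q\<bar> = a * (1 - q)"
  proof -
    have side: "\<bar>x - u\<bar> = a * (1 - r) \<longleftrightarrow>
       r \<le> 1 \<and> (x = u + a * (1 - r) \<or> x = u + (- a) * (1 - r))" for u r
    proof -
      have "r \<le> 1 \<longleftrightarrow> 0 \<le> a * (1 - r)" using a by (simp add: zero_le_mult_iff)
      then show ?thesis unfolding mult_minus_left by linarith
    qed
    show ?thesis unfolding side by blast
  qed
  also have "\<dots> \<longleftrightarrow> \<bar>x - s * midline xA yA xC yC y\<bar> = halfwidth a yA yC y"
  proof -
    \<comment> \<open>As \<open>yA\<close> and \<open>yC\<close> have opposite signs, so do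
      \<open>p\<close> and \<open>q\<close> away from the axis, and the negative one has weight 0.
      On the axis both alternatives say \<open>\<bar>x\<bar> = a\<close>.\<close>
    consider "p = 0" "q = 0" | "0 < p" "q < 0" | "p < 0" "0 < q"
      using y unfolding p_def q_def
      by (cases y "0 :: real" rule: linorder_cases) (auto simp: mult_less_0_iff zero_less_divide_iff divide_less_0_iff)
    then show ?thesis
      unfolding midline_def halfwidth_def weight_def p_def[symmetric] q_def[symmetric]
      by cases (simp_all add: mult_ac)
  qed
  finally show ?thesis .
qed

lemma sheared_quadrilateral_bounded:
  fixes a xA xC yA yC s :: real
  assumes a: "a > 0" and y: "yA * yC < 0"
    and z: "z \<in> sheared (midline xA yA xC yC) (halfwidth a yA yC) s"
  shows "norm z \<le> \<bar>s\<bar> * (\<bar>xA\<bar> + \<bar>xC\<bar>) + a + \<bar>yA\<bar> + \<bar>yC\<bar>"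
proof -
  obtain x y where xy: "z = (x, y)" by (cases z)
  let ?A = "weight yA y" and ?C = "weight yC y"
  have z': "\<bar>x - s * (xA * ?A + xC * ?C)\<bar> < a * (1 - ?A - ?C)"
    using z by (simp add: xy sheared_def midline_def halfwidth_def)
  have nn: "0 \<le> ?A" "0 \<le> ?C" by (simp_all add: weight_def)
  \<comment> \<open>A point of the region lies in a nonempty slice, so the weights sum to less than
    1; this bounds both coordinates.\<close>
  have "0 < a * (1 - ?A - ?C)" using z' by linarith
  then have lt: "?A + ?C < 1" using a by (simp add: zero_less_mult_iff)
  have "a * (1 - ?A - ?C) \<le> a * 1" using a nn by (intro mult_left_mono) auto
  moreover have "\<bar>xA * ?A + xC * ?C\<bar> \<le> \<bar>xA\<bar> + \<bar>xC\<bar>"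
  proof -
    have "\<bar>xA * ?A\<bar> \<le> \<bar>xA\<bar> * 1" "\<bar>xC * ?C\<bar> \<le> \<bar>xC\<bar> * 1"
      unfolding abs_mult using nn lt by (intro mult_left_mono; simp)+
    then show ?thesis by linarith
  qed
  then have "\<bar>s * (xA * ?A + xC * ?C)\<bar> \<le> \<bar>s\<bar> * (\<bar>xA\<bar> + \<bar>xC\<bar>)"
    unfolding abs_mult by (rule mult_left_mono) simp
  ultimately have x: "\<bar>x\<bar> \<le> \<bar>s\<bar> * (\<bar>xA\<bar> + \<bar>xC\<bar>) + a" using z' by linarith
  have "yA > 0 \<and> yC < 0 \<or> yA < 0 \<and> yC > 0" using y by (auto simp: mult_less_0_iff)
  then have "\<bar>y\<bar> \<le> \<bar>yA\<bar> + \<bar>yC\<bar>"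
    using lt nn by (auto simp: weight_def max_def field_simps split: if_splits)
  with x show ?thesis
    using norm_Pair_le[of x y] by (simp add: xy)
qed

text \<open>The polygon is where modulus and half-width agree; the two strict inequalities give the
  inner and the outer open set. Nonconvex quadrilaterals are covered, since their horizontal slices
  are intervals too.\<close>

lemma quadrilateral_eq_sheared:
  fixes a xA xC yA yC s :: real
  assumes a: "a > 0" and y: "yA * yC < 0"
  shows "quadrilateral (xA * s, yA) (a, 0) (xC * s, yC) (-a, 0)
    = sheared (midline xA yA xC yC) (halfwidth a yA yC) s"
proof -
  let ?m = "midline xA yA xC yC" and ?w = "halfwidth a yA yC"
  let ?U = "{z. ?w (snd z) < \<bar>fst z - s * ?m (snd z)\<bar>}"
  let ?S = "{z. \<bar>fst z - s * ?m (snd z)\<bar> = ?w (snd z)}"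
  have S: "path_image (linepath (xA * s, yA) (a, 0) +++ linepath (a, 0) (xC * s, yC)
      +++ linepath (xC * s, yC) (-a, 0) +++ linepath (-a, 0) (xA * s, yA)) = ?S"
  proof (rule set_eqI)
    fix z :: "real \<times> real"
    show "z \<in> path_image (linepath (xA * s, yA) (a, 0) +++ linepath (a, 0) (xC * s, yC)
      +++ linepath (xC * s, yC) (-a, 0) +++ linepath (-a, 0) (xA * s, yA)) \<longleftrightarrow> z \<in> ?S"
      using sides_iff[OF assms, of "fst z" "snd z" xA s xC]
      by (simp add: path_image_join Un_assoc)
  qed
  show ?thesis
    unfolding quadrilateral_def S
  proof (rule inside_eqI)
    show "open (sheared ?m ?w s)" "open ?U"
      unfolding sheared_def midline_def halfwidth_def
      by (intro open_Collect_less continuous_intros)+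
    show "bounded (sheared ?m ?w s)"
      using sheared_quadrilateral_bounded[OF assms] unfolding bounded_iff by blast
    \<comment> \<open>Moving horizontally away from the midline keeps the height and only increases
      the modulus.\<close>
    show "\<exists>v. v \<noteq> 0 \<and> (\<forall>t\<ge>0. z + t *\<^sub>R v \<in> ?U)" if z: "z \<in> ?U" for z
    proof (cases "0 \<le> fst z - s * ?m (snd z)")
      case True
      then show ?thesis using z by (intro exI[of _ "(1, 0)"]) (auto simp: zero_prod_def)
    next
      case False
      then show ?thesis using z by (intro exI[of _ "(-1, 0)"]) (auto simp: zero_prod_def)
    qed
  qed (auto simp: sheared_def)
qed

section \<open>Reduction to a positive kernel\<close>

lemma positive_kernel_shift:
  fixes K :: "real \<Rightarrow> real"
  assumes cont: "continuous_on {0<..} K" and anti: "strict_antimono_on {0<..} K"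
    and int: "set_integrable lborel {0<..<1} (\<lambda>r. K r * r)" and M: "1 < M"
  obtains L c where "positive_kernel L"
    "(\<integral>\<^sup>+r. ennreal (r * L r) * indicator {0<..<1} r \<partial>lborel) < \<infinity>"
    "\<And>r. 0 < r \<Longrightarrow> r < M \<Longrightarrow> K r = L r + c"
proof -
  \<comment> \<open>\<open>K\<close> may become negative, so it is shifted to the value 1 at
    \<open>M\<close> and continued by \<open>exp (M - r)\<close>, which also equals 1 there, stays
    positive and decreases strictly. As \<open>M > 1\<close>, the shifted formula holds on all of
    \<open>(0, 1)\<close>.\<close>
  define L where "L r = (if r \<le> 0 then 0 else if r \<le> M then K r - K M + 1 else exp (M - r))" for r
  have K: "K r' < K r" if "0 < r" "r < r'" for r r'
    using anti that by (auto simp: monotone_on_def)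
  have L: "positive_kernel L"
  proof
    have "continuous_on {0<..} (\<lambda>r. if r \<le> M then K r - K M + 1 else exp (M - r))"
      by (intro continuous_on_cases_le continuous_intros continuous_on_subset[OF cont]) auto
    then show "continuous_on {0<..} L"
      by (rule continuous_on_eq) (auto simp: L_def)
    show "0 < L r" if "0 < r" for r
      using K[of r M] that by (cases "r = M") (auto simp: L_def)
    show "L r' < L r" if "0 < r" "r < r'" for r r'
    proof -
      consider "r' \<le> M" | "r \<le> M" "M < r'" | "M < r" by linarith
      then show ?thesis
      proof cases
        case 2
        then have "L r' < 1" "1 \<le> L r"
          using K[of r M] that M by (cases "r = M"; auto simp: L_def)+
        then show ?thesis by simp
      qed (use K that in \<open>auto simp: L_def\<close>)
    qed
  qed (simp add: L_def)
  have "set_integrable lborel {0<..<1} (\<lambda>r. K r * r + (1 - K M) * r)"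
    using int
  proof (rule set_integral_add)
    have "set_integrable lborel {0..1} (\<lambda>r. (1 - K M) * r)"
      by (intro borel_integrable_atLeastAtMost') (intro continuous_intros)
    then show "set_integrable lborel {0<..<1} (\<lambda>r. (1 - K M) * r)"
      by (rule set_integrable_subset) auto
  qed
  then have "set_integrable lborel {0<..<1} (\<lambda>r. r * L r)"
    by (rule iffD1[OF set_integrable_cong, rotated -1]) (use M in \<open>auto simp: L_def algebra_simps\<close>)
  then have "(\<integral>\<^sup>+r. ennreal (norm (indicator {0<..<1} r *\<^sub>R (r * L r))) \<partial>lborel) < \<infinity>"
    unfolding set_integrable_def integrable_iff_bounded by blast
  also have "(\<integral>\<^sup>+r. ennreal (norm (indicator {0<..<1} r *\<^sub>R (r * L r))) \<partial>lborel)
      = (\<integral>\<^sup>+r. ennreal (r * L r) * indicator {0<..<1} r \<partial>lborel)"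
    using positive_kernel.positive[OF L]
    by (intro nn_integral_cong) (auto simp: indicator_def less_imp_le)
  finally show ?thesis
    by (intro that[OF L, of "K M - 1"]) (use M in \<open>auto simp: L_def\<close>)
qed

section \<open>Strict monotonicity along the family of quadrilaterals\<close>

theorem theorem1p7:
  fixes K :: "real \<Rightarrow> real" and a xA xC yA yC :: real
  assumes "K C1_differentiable_on {0<..}"
    and "strict_antimono_on {0<..} K"
    and "set_integrable lborel {0<..<1} (\<lambda>r. K r * r)"
    and "a > 0"
    and "yA * yC < 0"
    and "xA \<noteq> 0" and "xC \<noteq> 0"
  shows "strict_mono_on {0..1}
    (\<lambda>t::real. energy K (quadrilateral (xA * (1 - t), yA) (a, 0) (xC * (1 - t), yC) (-a, 0)))"
proof -
  note a = assms(4) and y = assms(5)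
  let ?m = "midline xA yA xC yC" and ?w = "halfwidth a yA yC"
  let ?\<Omega> = "sheared ?m ?w"
  define B where "B = \<bar>xA\<bar> + \<bar>xC\<bar> + a + \<bar>yA\<bar> + \<bar>yC\<bar>"
  have "B > 0" using a by (simp add: B_def)
  have bound: "norm z \<le> B" if s: "\<bar>s\<bar> \<le> 1" and z: "z \<in> ?\<Omega> s" for s z
    using sheared_quadrilateral_bounded[OF a y z] mult_right_mono[OF s, of "\<bar>xA\<bar> + \<bar>xC\<bar>"]
    by (simp add: B_def)
  \<comment> \<open>For \<open>\<bar>s\<bar> \<le> 1\<close> the region lies in the ball of radius
    \<open>B\<close>, so distances stay below \<open>2 * B + 1\<close>, which also exceeds
    1.\<close>
  obtain L c where L: "positive_kernel L"
    and fin: "(\<integral>\<^sup>+r. ennreal (r * L r) * indicator {0<..<1} r \<partial>lborel) < \<infinity>"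
    and K: "\<And>r. 0 < r \<Longrightarrow> r < 2 * B + 1 \<Longrightarrow> K r = L r + c"
    using positive_kernel_shift[OF C1_differentiable_imp_continuous_on[OF assms(1)] assms(2,3), of "2 * B + 1"]
      \<open>B > 0\<close> by auto
  interpret positive_kernel L by (rule L)
  have \<Omega>_fin: "emeasure lborel (?\<Omega> s) < \<infinity>" if "\<bar>s\<bar> \<le> 1" for s
  proof (rule emeasure_bounded_finite)
    show "bounded (?\<Omega> s)" using bound[OF that] unfolding bounded_iff by blast
  qed
  define c' where "c' = c * (measure lborel (?\<Omega> 0))\<^sup>2"
  have energy: "energy K (?\<Omega> s) = enn2real (nn_energy L (?\<Omega> s)) + c'" if s: "\<bar>s\<bar> \<le> 1" for s
  proof -
    have "norm (z - z') < 2 * B + 1" if "z \<in> ?\<Omega> s" "z' \<in> ?\<Omega> s" for z z'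
      using norm_triangle_ineq4[of z z'] bound[OF s that(1)] bound[OF s that(2)] by linarith
    moreover have "measure lborel (?\<Omega> s) = measure lborel (?\<Omega> 0)"
      by (simp add: measure_def emeasure_sheared)
    ultimately show ?thesis
      using energy_eq_nn_energy[OF fin _ \<Omega>_fin[OF s], of "2 * B + 1" K c] K by (simp add: c'_def)
  qed
  have less: "energy K (?\<Omega> s') < energy K (?\<Omega> s)" if s: "\<bar>s\<bar> < \<bar>s'\<bar>" and s': "\<bar>s'\<bar> \<le> 1" for s s'
  proof -
    have fin': "nn_energy L (?\<Omega> r) < \<infinity>" if "\<bar>r\<bar> \<le> 1" for r
      using nn_energy_finite[OF fin _ \<Omega>_fin[OF that]] by simp
    \<comment> \<open>Strictly between the axis and \<open>yA\<close> only the weight at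
      \<open>A\<close> is nonzero: the half-width is positive and the midline is
      \<open>xA * u / yA\<close>, injective because \<open>xA \<noteq> 0\<close>.\<close>
    have weights: "weight yA u = u / yA" "weight yC u = 0" "u / yA < 1" if u: "u \<in> {min 0 yA<..<max 0 yA}" for u
      using u y by (auto simp: weight_def mult_less_0_iff max_def min_def field_simps split: if_splits)
    have "nn_energy L (?\<Omega> s') < nn_energy L (?\<Omega> s)"
    proof (rule nn_energy_sheared_less[OF _ _ s])
      show "nn_energy L (?\<Omega> s') \<noteq> \<infinity>" using fin'[OF s'] by simp
      show "min 0 yA < max 0 yA" using y by (cases yA "0 :: real" rule: linorder_cases) auto
      show "0 < ?w u" if "u \<in> {min 0 yA<..<max 0 yA}" for u
        using weights[OF that] a by (simp add: halfwidth_def)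
      show "inj_on ?m {min 0 yA<..<max 0 yA}"
        using \<open>xA \<noteq> 0\<close> y by (intro inj_onI) (auto simp: midline_def weights)
    qed measurable
    then show ?thesis
      using fin' s s' by (simp add: energy enn2real_less_iff)
  qed
  \<comment> \<open>As \<open>t\<close> increases in \<open>[0, 1]\<close>, \<open>s = 1 - t\<close>
    decreases in modulus, so the energy grows.\<close>
  show ?thesis
    by (rule strict_mono_onI) (auto simp: quadrilateral_eq_sheared[OF a y] intro!: less)
qed

end
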